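(* Let $n,p,s\in\mathbb{N}$ with $1\le s\le p$, let $X$ be a real $n\times p$ matrix, and let $\delta=\delta(X,s)$. Assume $\delta<1$. Then $$\mathbb{E}\left[\gamma_{\mathcal{M}_s,\infty}\right]\;\le\;\sqrt{2\log(2p)}+2\,\delta\left(\frac{\sqrt{1+\delta}}{1-\delta}\right)\sqrt{2s\log(6p/s)} .$$
   Context: $X$ is a real $n\times p$ matrix (it is not assumed that $n\ge p$); $X_M$ denotes the submatrix of $X$ formed by the columns with indices in $M\subset\{1,\ldots,p\}$, and $^t$ denotes transpose. For a symmetric nonnegative matrix $A$, $\mathrm{corr}(A)=(\mathrm{diag}(A)^\dagger)^{1/2}A(\mathrm{diag}(A)^\dagger)^{1/2}$, where $\mathrm{diag}(A)$ is obtained from $A$ by setting all off-diagonal entries to zero and $B^\dagger$ is the Moore-Penrose pseudo-inverse of $B$. Define $$\delta(X,s)=\sup_{M\subset\{1,\ldots,p\},\,1\le |M|\le s}\left\|\mathrm{corr}(X_M^tX_M)-I_{|M|}\right\|_{op},$$ with $\|\cdot\|_{op}$ the Euclidean operator norm. Let $\mathcal{M}_s$ be the set of non-empty $M\subset\{1,\ldots,p\}$ with $|M|\le s$. (When $\delta(X,s)<1$, every $X_M$ with $M\in\mathcal{M}_s$ has full column rank.) For $M\in\mathcal{M}_s$ and $i\in M$, let $i.M\in\{1,\ldots,|M|\}$ be the rank of $i$ among the elements of $M$ in increasing order, let $e_a^b$ be the $a$-th standard basis column vector of $\mathbb{R}^b$, and set $$v_{M,i}^t=(e_{i.M}^{|M|})^t(X_M^tX_M)^{-1}X_M^t,\qquad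 w_{M,i}=v_{M,i}/\|v_{M,i}\| \ (\text{and } w_{M,i}=0 \text{ if } v_{M,i}=0).$$ With $\xi$ a standard Gaussian vector in $\mathbb{R}^n$ (mean zero, identity covariance), define $$\gamma_{\mathcal{M}_s,\infty}=\max_{M\in\mathcal{M}_s,\ i\in M}|w_{M,i}^t\xi| .$$ *)

theory Defs
  imports
    "HOL-Probability.Probability"
    "Jordan_Normal_Form.Gauss_Jordan_Elimination"
    "Jordan_Normal_Form.DL_Submatrix"
begin

unbundle no vec_syntax
no_notation inner (infix "\<bullet>" 70)

text \<open>
  Matrices and vectors are those of \<^theory>\<open>Jordan_Normal_Form.Matrix\<close>, whose indices start at 0:
  the columns of an \<open>n \<times> p\<close> matrix are indexed by \<open>{..<p}\<close> instead of \<open>{1, \<dots>, p}\<close>.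
\<close>

definition norm2 :: "real vec \<Rightarrow> real" where
  "norm2 v = L2_set (\<lambda>i. v $ i) {..<dim_vec v}"

definition op_norm :: "real mat \<Rightarrow> real" where
  "op_norm A = (SUP v\<in>{v \<in> carrier_vec (dim_col A). norm2 v \<le> 1}. norm2 (A *\<^sub>v v))"

definition diag_part :: "real mat \<Rightarrow> real mat" where
  "diag_part A = mat (dim_row A) (dim_col A) (\<lambda>(i, j). if i = j then A $$ (i, j) else 0)"

text \<open>The four Penrose conditions, which have exactly one solution for every real matrix.\<close>

definition is_pseudo_inverse :: "real mat \<Rightarrow> real mat \<Rightarrow> bool" where
  "is_pseudo_inverse A B \<longleftrightarrow>
     B \<in> carrier_mat (dim_col A) (dim_row A) \<and>
     A * B * A = A \<and> B * A * B = B \<and>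
     transpose_mat (A * B) = A * B \<and> transpose_mat (B * A) = B * A"

definition pseudo_inverse :: "real mat \<Rightarrow> real mat" where
  "pseudo_inverse A = (THE B. is_pseudo_inverse A B)"

definition nonneg_mat :: "real mat \<Rightarrow> bool" where
  "nonneg_mat A \<longleftrightarrow>
     square_mat A \<and> transpose_mat A = A \<and>
     (\<forall>v \<in> carrier_vec (dim_row A). 0 \<le> v \<bullet> (A *\<^sub>v v))"

text \<open>The unique symmetric nonnegative square root; meaningful only if \<open>nonneg_mat A\<close>.\<close>

definition sqrt_mat :: "real mat \<Rightarrow> real mat" where
  "sqrt_mat A = (THE B. nonneg_mat B \<and> B * B = A)"

definition corr :: "real mat \<Rightarrow> real mat" where
  "corr A = (let D = sqrt_mat (pseudo_inverse (diag_part A)) in D * A * D)"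

definition cols_sub :: "real mat \<Rightarrow> nat set \<Rightarrow> real mat" where
  "cols_sub X M = submatrix X UNIV M"

definition gram :: "real mat \<Rightarrow> real mat" where
  "gram A = transpose_mat A * A"

definition models :: "nat \<Rightarrow> nat \<Rightarrow> nat set set" where
  "models p s = {M. M \<subseteq> {..<p} \<and> M \<noteq> {} \<and> card M \<le> s}"

definition rip_const :: "real mat \<Rightarrow> nat \<Rightarrow> real" where
  "rip_const X s =
     (SUP M\<in>models (dim_col X) s. op_norm (corr (gram (cols_sub X M)) - 1\<^sub>m (card M)))"

text \<open>The 0-based rank of \<open>i\<close> among the elements of \<open>M\<close> in increasing order.\<close>

definition rank_in :: "nat set \<Rightarrow> nat \<Rightarrow> nat" where
  "rank_in M i = card {a \<in> M. a < i}"

text \<open>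
  Column vector form of \<open>e\<^sup>t (X\<^sub>M\<^sup>t X\<^sub>M)\<^sup>-\<^sup>1 X\<^sub>M\<^sup>t\<close>. The value is unspecified if \<open>X\<^sub>M\<^sup>t X\<^sub>M\<close> is singular
  (\<^const>\<open>mat_inverse\<close> is then \<^const>\<open>None\<close>), which does not happen when \<open>rip_const X s < 1\<close> and
  \<open>M \<in> models (dim_col X) s\<close>.
\<close>

definition proj_vec :: "real mat \<Rightarrow> nat set \<Rightarrow> nat \<Rightarrow> real vec" where
  "proj_vec X M i =
     (let XM = cols_sub X M in
      transpose_mat (the (mat_inverse (gram XM)) * transpose_mat XM) *\<^sub>v
        unit_vec (card M) (rank_in M i))"

definition proj_dir :: "real mat \<Rightarrow> nat set \<Rightarrow> nat \<Rightarrow> real vec" where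
  "proj_dir X M i =
     (let v = proj_vec X M i in
      if v = 0\<^sub>v (dim_row X) then 0\<^sub>v (dim_row X) else (1 / norm2 v) \<cdot>\<^sub>v v)"

definition max_stat :: "real mat \<Rightarrow> nat \<Rightarrow> real vec \<Rightarrow> real" where
  "max_stat X s z =
     Max {\<bar>proj_dir X M i \<bullet> z\<bar> | M i. M \<in> models (dim_col X) s \<and> i \<in> M}"

definition std_gaussian_vec :: "'a measure \<Rightarrow> nat \<Rightarrow> ('a \<Rightarrow> real vec) \<Rightarrow> bool" where
  "std_gaussian_vec P n \<xi> \<longleftrightarrow>
     prob_space P \<and>
     (\<forall>\<omega>\<in>space P. \<xi> \<omega> \<in> carrier_vec n) \<and>
     (\<forall>i<n. distributed P lborel (\<lambda>\<omega>. \<xi> \<omega> $ i) (\<lambda>x. ennreal (std_normal_density x))) \<and>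
     prob_space.indep_vars P (\<lambda>_. borel) (\<lambda>i \<omega>. \<xi> \<omega> $ i) {..<n}"

end

theory Submission
  imports Defs "Jordan_Normal_Form.Determinant"
begin

text \<open>
  Let \<open>u\<^sub>j\<close> be the normalised columns of \<open>X\<close> and \<open>g\<^sub>j = u\<^sub>j \<bullet> \<xi>\<close>. The Gram matrix \<open>G\<close> of the \<open>u\<^sub>j\<close>,
  \<open>j \<in> M\<close>, is within \<open>\<delta>\<close> of the identity, and \<open>w\<close> is the combination of these columns with
  coefficients \<open>b / \<surd>(b\<^sub>i)\<close>, where \<open>G b = e\<^sub>i\<close>. These coefficients are within \<open>2 \<delta> / (1 - \<delta>)\<close> of \<open>e\<^sub>i\<close>,
  hence by Cauchy-Schwarz \<open>\<bar>w \<bullet> \<xi>\<bar>\<close> is at most \<open>\<bar>g\<^sub>i\<bar>\<close> plus \<open>2 \<delta> / (1 - \<delta>)\<close> times the root of the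
  sum of \<open>g\<^sub>j\<^sup>2\<close> over \<open>M\<close>. The maximum of the \<open>\<bar>g\<^sub>i\<bar>\<close> and the sum of the \<open>s\<close> largest \<open>g\<^sub>j\<^sup>2\<close> are then
  bounded pointwise by affine functions of sums of \<open>cosh (l g\<^sub>j)\<close>, whose expectation is
  \<open>exp (l\<^sup>2 / 2)\<close> whatever the dependence between the \<open>g\<^sub>j\<close>; so no union bound over models occurs.
\<close>

subsection \<open>Norms and the correlation matrix\<close>

lemma norm2_square: "(norm2 v)\<^sup>2 = v \<bullet> v"
  by (simp add: norm2_def L2_set_def scalar_prod_def sum_nonneg power2_eq_square atLeast0LessThan)

lemma norm2_nonneg [simp]: "0 \<le> norm2 v"
  by (simp add: norm2_def)

lemma norm2_smult: "norm2 (c \<cdot>\<^sub>v v) = \<bar>c\<bar> * norm2 v"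
proof -
  have "norm2 (c \<cdot>\<^sub>v v) = L2_set (\<lambda>i. \<bar>c\<bar> * v $ i) {..<dim_vec v}"
    by (simp add: norm2_def L2_set_def power_mult_distrib)
  also have "\<dots> = \<bar>c\<bar> * norm2 v"
    by (simp add: norm2_def L2_set_right_distrib)
  finally show ?thesis .
qed

lemma norm2_eq_0_iff: "norm2 v = 0 \<longleftrightarrow> v = 0\<^sub>v (dim_vec v)"
  unfolding norm2_def by (subst L2_set_eq_0_iff) (auto simp: vec_eq_iff)

text \<open>The supremum is one of reals, so its set must first be shown bounded: on the unit ball
  the sum of the absolute values of all entries is a crude bound. The rest is scaling
  \<open>v\<close> to norm 1.\<close>

lemma norm2_le_op_norm:
  fixes A :: "real mat" and v :: "real vec"
  assumes "v \<in> carrier_vec (dim_col A)"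
  shows "norm2 (A *\<^sub>v v) \<le> op_norm A * norm2 v"
proof (cases "norm2 v = 0")
  case True
  then have "v = 0\<^sub>v (dim_col A)"
    using assms norm2_eq_0_iff by auto
  then have "A *\<^sub>v v = 0\<^sub>v (dim_row A)"
    by (auto simp: scalar_prod_def)
  then show ?thesis
    using True norm2_eq_0_iff[of "A *\<^sub>v v"] by auto
next
  case False
  let ?B = "{v \<in> carrier_vec (dim_col A). norm2 v \<le> 1}"
  have "norm2 (A *\<^sub>v w) \<le> (\<Sum>i<dim_row A. \<Sum>j<dim_col A. \<bar>A $$ (i, j)\<bar>)" if w: "w \<in> ?B" for w
  proof -
    have w1: "\<bar>w $ j\<bar> \<le> 1" if "j < dim_col A" for j
    proof -
      have "\<bar>w $ j\<bar> \<le> L2_set (\<lambda>i. \<bar>w $ i\<bar>) {..<dim_vec w}"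
        using that w by (intro member_le_L2_set) auto
      also have "\<dots> = norm2 w"
        by (simp add: norm2_def L2_set_def)
      finally show ?thesis using w by simp
    qed
    have "norm2 (A *\<^sub>v w) \<le> (\<Sum>i<dim_row A. \<bar>(A *\<^sub>v w) $ i\<bar>)"
      using L2_set_le_sum_abs[of "\<lambda>i. (A *\<^sub>v w) $ i" "{..<dim_row A}"]
      by (simp add: norm2_def del: index_mult_mat_vec)
    also have "\<dots> \<le> (\<Sum>i<dim_row A. \<Sum>j<dim_col A. \<bar>A $$ (i, j)\<bar>)"
    proof (rule sum_mono)
      fix i assume "i \<in> {..<dim_row A}"
      then have "\<bar>(A *\<^sub>v w) $ i\<bar> = \<bar>\<Sum>j<dim_col A. A $$ (i, j) * w $ j\<bar>"
        using w by (auto simp: scalar_prod_def atLeast0LessThan)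
      also have "\<dots> \<le> (\<Sum>j<dim_col A. \<bar>A $$ (i, j)\<bar>)"
        using w1 by (intro order_trans[OF sum_abs] sum_mono)
          (auto simp: abs_mult intro: mult_left_le)
      finally show "\<bar>(A *\<^sub>v w) $ i\<bar> \<le> (\<Sum>j<dim_col A. \<bar>A $$ (i, j)\<bar>)" .
    qed
    finally show ?thesis .
  qed
  then have bdd: "bdd_above ((\<lambda>v. norm2 (A *\<^sub>v v)) ` ?B)"
    by (auto intro!: bdd_aboveI2)
  have pos: "0 < norm2 v"
    using False norm2_nonneg[of v] by linarith
  have "norm2 (A *\<^sub>v ((1 / norm2 v) \<cdot>\<^sub>v v)) \<le> op_norm A"
    unfolding op_norm_def using assms pos by (intro cSUP_upper bdd) (auto simp: norm2_smult)
  moreover have "A *\<^sub>v ((1 / norm2 v) \<cdot>\<^sub>v v) = (1 / norm2 v) \<cdot>\<^sub>v (A *\<^sub>v v)"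
    using mult_mat_vec[of A "dim_row A" "dim_col A" v] assms by auto
  ultimately show ?thesis
    using pos by (simp add: norm2_smult divide_le_eq)
qed

lemma finite_models: "finite (models p s)"
  by (rule finite_subset[of _ "Pow {..<p}"]) (auto simp: models_def)

text \<open>There are only finitely many models, so the supremum over them is an upper
  bound.\<close>

lemma norm2_le_rip_const:
  fixes v :: "real vec"
  assumes "M \<in> models (dim_col X) s"
    and "v \<in> carrier_vec (dim_col (corr (gram (cols_sub X M)) - 1\<^sub>m (card M)))"
  shows "norm2 ((corr (gram (cols_sub X M)) - 1\<^sub>m (card M)) *\<^sub>v v) \<le> rip_const X s * norm2 v"
proof -
  have "op_norm (corr (gram (cols_sub X M)) - 1\<^sub>m (card M)) \<le> rip_const X s"
    unfolding rip_const_def using assms(1) finite_models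
    by (intro cSUP_upper) (auto intro!: bdd_above_finite)
  then show ?thesis
    using norm2_le_op_norm[OF assms(2)] by (meson mult_right_mono norm2_nonneg order_trans)
qed

section \<open>Pseudo-inverses and square roots of diagonal matrices, and an entrywise formula for
  \<open>corr\<close>\<close>

text \<open>Uniqueness of the Moore-Penrose inverse: symmetry of the products gives
  \<open>A * B = A * C\<close> and \<open>B * A = C * A\<close>, whence
  \<open>C = C * A * C = B * A * B = B\<close>.\<close>

lemma pseudo_inverse_eqI:
  assumes "is_pseudo_inverse A B"
  shows "pseudo_inverse A = B"
  unfolding pseudo_inverse_def
proof (rule the_equality[where P = "is_pseudo_inverse A", OF assms])
  fix C assume C: "is_pseudo_inverse A C"
  define m n where "m = dim_row A" and "n = dim_col A"
  have A: "A \<in> carrier_mat m n" and cB: "B \<in> carrier_mat n m" and cC: "C \<in> carrier_mat n m"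
    using assms C by (auto simp: m_def n_def is_pseudo_inverse_def)
  note B' = assms[unfolded is_pseudo_inverse_def] and C' = C[unfolded is_pseudo_inverse_def]
  note as = assoc_mult_mat[where ?'a = real]
  have "A * B = A * C * (A * B)"
    using B' C' A cB cC as[OF A cC A] as[of "A * C" m m A n B m] by auto
  also have "\<dots> = transpose_mat (A * C) * transpose_mat (A * B)"
    using B' C' by simp
  also have "\<dots> = transpose_mat (A * B * (A * C))"
    using A cB cC by (intro transpose_mult[symmetric]) auto
  also have "A * B * (A * C) = A * C"
    using B' A cB cC as[of "A * B" m m A n C m] by auto
  also have "transpose_mat (A * C) = A * C"
    using C' by simp
  finally have AB: "A * B = A * C" .
  have "B * A = B * A * (C * A)"
    using C' A cB cC as[of B n m A n "C * A" n] as[OF A cC A] by auto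
  also have "\<dots> = transpose_mat (B * A) * transpose_mat (C * A)"
    using B' C' by simp
  also have "\<dots> = transpose_mat (C * A * (B * A))"
    using A cB cC by (intro transpose_mult[symmetric]) auto
  also have "C * A * (B * A) = C * A"
    using B' A cB cC as[of C n m A n "B * A" n] as[OF A cB A] by auto
  also have "transpose_mat (C * A) = C * A"
    using C' by simp
  finally have BA: "B * A = C * A" .
  have "C = C * A * C" using C' by simp
  also have "\<dots> = B * A * C" using BA by simp
  also have "\<dots> = B * (A * B)" using as[OF cB A cC] AB by simp
  also have "\<dots> = B" using as[OF cB A cB] B' by simp
  finally show "C = B" .
qed

lemma dim_mat_diag [simp]: "dim_row (mat_diag n f) = n" "dim_col (mat_diag n f) = n"
  by (auto simp: mat_diag_def)

lemma transpose_mat_diag: "transpose_mat (mat_diag n f) = mat_diag n f"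
  by (auto simp: mat_diag_def)

text \<open>Zero entries need no separate treatment because \<open>inverse 0 = 0\<close>.\<close>

lemma pseudo_inverse_mat_diag:
  "pseudo_inverse (mat_diag n f) = mat_diag n (\<lambda>i. inverse (f i))"
proof (rule pseudo_inverse_eqI)
  have *: "f i * inverse (f i) * f i = f i" "inverse (f i) * f i * inverse (f i) = inverse (f i)" for i
    by (cases "f i = 0"; simp)+
  show "is_pseudo_inverse (mat_diag n f) (mat_diag n (\<lambda>i. inverse (f i)))"
    unfolding is_pseudo_inverse_def
    by (simp add: transpose_mat_diag *)
qed

lemma mat_diag_mult_vec_index:
  fixes v :: "real vec"
  assumes "v \<in> carrier_vec n" "i < n"
  shows "(mat_diag n f *\<^sub>v v) $ i = f i * v $ i"
proof -
  have "(mat_diag n f *\<^sub>v v) $ i = (\<Sum>j<n. (if i = j then f j else 0) * v $ j)"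
    using assms by (auto simp: mat_diag_def scalar_prod_def atLeast0LessThan)
  also have "\<dots> = (\<Sum>j<n. if i = j then f j * v $ j else 0)"
    by (intro sum.cong) auto
  also have "\<dots> = f i * v $ i" using assms by simp
  finally show ?thesis .
qed

lemma nonneg_mat_diag:
  assumes "\<And>i. i < n \<Longrightarrow> 0 \<le> f i"
  shows "nonneg_mat (mat_diag n f)"
proof -
  have "v \<bullet> (mat_diag n f *\<^sub>v v) = (\<Sum>i<n. v $ i * (f i * v $ i))" if "v \<in> carrier_vec n" for v
    using that unfolding scalar_prod_def
    by (intro sum.cong) (auto simp: mat_diag_mult_vec_index simp del: index_mult_mat_vec)
  moreover have "0 \<le> (\<Sum>i<n. v $ i * (f i * v $ i))" for v
    using assms by (intro sum_nonneg) (simp add: mult.left_commute[of _ "f _"])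
  ultimately show ?thesis
    unfolding nonneg_mat_def by (simp add: transpose_mat_diag)
qed

text \<open>
  For \<open>B\<close> nonnegative with \<open>B\<^sup>2 = diag f\<close>, the vector \<open>y = B e\<^sub>a - \<surd>(f a) e\<^sub>a\<close> satisfies
  \<open>B y = - \<surd>(f a) y\<close>, which forces \<open>y = 0\<close>.
\<close>
lemma sqrt_mat_diag:
  assumes f: "\<And>i. i < n \<Longrightarrow> 0 \<le> f i"
  shows "sqrt_mat (mat_diag n f) = mat_diag n (\<lambda>i. sqrt (f i))"
  unfolding sqrt_mat_def
proof (rule the_equality)
  have "mat_diag n (\<lambda>i. sqrt (f i)) * mat_diag n (\<lambda>i. sqrt (f i)) = mat_diag n f"
    unfolding mat_diag_diag using f by (auto simp: mat_diag_def)
  then show "nonneg_mat (mat_diag n (\<lambda>i. sqrt (f i))) \<and>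
      mat_diag n (\<lambda>i. sqrt (f i)) * mat_diag n (\<lambda>i. sqrt (f i)) = mat_diag n f"
    using f by (simp add: nonneg_mat_diag)
next
  fix B assume "nonneg_mat B \<and> B * B = mat_diag n f"
  then have sq: "dim_row B = dim_col B" and sym: "transpose_mat B = B"
    and nonneg: "\<And>v. v \<in> carrier_vec (dim_row B) \<Longrightarrow> 0 \<le> v \<bullet> (B *\<^sub>v v)"
    and BB: "B * B = mat_diag n f"
    by (auto simp: nonneg_mat_def)
  have B: "B \<in> carrier_mat n n"
    using arg_cong[OF BB, of dim_row] sq by (auto simp: mat_diag_def)
  have col: "B *\<^sub>v unit_vec n a = sqrt (f a) \<cdot>\<^sub>v unit_vec n a" if a: "a < n" for a
  proof -
    let ?e = "unit_vec n a :: real vec" and ?c = "sqrt (f a)"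
    have e: "?e \<in> carrier_vec n" by simp
    have Be: "B *\<^sub>v ?e \<in> carrier_vec n" using B by auto
    define y where "y = B *\<^sub>v ?e - ?c \<cdot>\<^sub>v ?e"
    have y: "y \<in> carrier_vec n" using B by (auto simp: y_def)
    have BBe: "B *\<^sub>v (B *\<^sub>v ?e) = f a \<cdot>\<^sub>v ?e"
    proof -
      have "B *\<^sub>v (B *\<^sub>v ?e) = mat_diag n f *\<^sub>v ?e"
        using assoc_mult_mat_vec[OF B B e] BB by simp
      also have "\<dots> = f a \<cdot>\<^sub>v ?e"
        by (rule eq_vecI, subst mat_diag_mult_vec_index[OF e])
          (auto simp: mat_diag_def unit_vec_def)
      finally show ?thesis .
    qed
    have "B *\<^sub>v y = B *\<^sub>v (B *\<^sub>v ?e) - ?c \<cdot>\<^sub>v (B *\<^sub>v ?e)"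
      unfolding y_def using mult_minus_distrib_mat_vec[OF B Be] mult_mat_vec[OF B e] by auto
    also have "\<dots> = - ?c \<cdot>\<^sub>v y"
      unfolding BBe y_def using B f[OF a]
      by (intro eq_vecI) (auto simp: algebra_simps)
    finally have By: "B *\<^sub>v y = - ?c \<cdot>\<^sub>v y" .
    have "y \<bullet> y = 0"
    \<comment> \<open>If \<open>f a > 0\<close>, nonnegativity of the quadratic form at
      \<open>y\<close> gives the claim. If \<open>f a = 0\<close>, the form carries no sign
      information; instead \<open>B y = 0\<close> and \<open>y = B e\<close>, so symmetry moves
      \<open>B\<close> across the product.\<close>
    proof (cases "f a = 0")
      case True
      have y': "y = B *\<^sub>v ?e" using B True by (auto simp: y_def intro!: eq_vecI)
      have "y \<bullet> y = (B *\<^sub>v y) \<bullet> ?e"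
        using transpose_vec_mult_scalar[OF B e y] sym unfolding y'
        by (metis Be By comm_scalar_prod e mult_mat_vec_carrier B y y' transpose_carrier_mat)
      then show ?thesis using By True y by (simp add: scalar_prod_smult_left)
    next
      case False
      then have "0 < ?c" using f[OF a] by simp
      moreover have "0 \<le> - ?c * (y \<bullet> y)"
        using nonneg[of y] y B By by simp
      moreover have "0 \<le> y \<bullet> y"
        using norm2_square[of y] by (metis zero_le_power2)
      ultimately show ?thesis
        by (smt (verit, best) mult_minus_left mult_pos_pos)
    qed
    then have "y = 0\<^sub>v n"
      using norm2_square[of y] norm2_eq_0_iff[of y] y by auto
    show ?thesis
    proof (rule eq_vecI)
      fix i assume "i < dim_vec (?c \<cdot>\<^sub>v ?e)"
      then have "i < n" by simp
      then have "y $ i = 0" using \<open>y = 0\<^sub>v n\<close> by simp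
      then show "(B *\<^sub>v ?e) $ i = (?c \<cdot>\<^sub>v ?e) $ i"
        using \<open>i < n\<close> B by (simp add: y_def)
    qed (use B in auto)
  qed
  show "B = mat_diag n (\<lambda>i. sqrt (f i))"
  proof (rule eq_matI)
    fix i j assume "i < dim_row (mat_diag n (\<lambda>i. sqrt (f i)))" "j < dim_col (mat_diag n (\<lambda>i. sqrt (f i)))"
    then have ij: "i < n" "j < n" by (auto simp: mat_diag_def)
    have "B $$ (i, j) = (B *\<^sub>v unit_vec n j) $ i"
      using ij B by (simp add: scalar_prod_right_unit)
    then show "B $$ (i, j) = mat_diag n (\<lambda>i. sqrt (f i)) $$ (i, j)"
      using ij by (auto simp: col mat_diag_def)
  qed (use B in \<open>auto simp: mat_diag_def\<close>)
qed

text \<open>Division by zero yields 0, which agrees with the pseudo-inverse, so the formula also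
  covers vanishing diagonal entries.\<close>

lemma corr_eq:
  assumes A: "A \<in> carrier_mat m m" and nonneg: "\<And>i. i < m \<Longrightarrow> 0 \<le> A $$ (i, i)"
  shows "corr A = mat m m (\<lambda>(i, j). A $$ (i, j) / (sqrt (A $$ (i, i)) * sqrt (A $$ (j, j))))"
proof -
  have "diag_part A = mat_diag m (\<lambda>i. A $$ (i, i))"
    using A by (auto simp: diag_part_def mat_diag_def)
  then have "sqrt_mat (pseudo_inverse (diag_part A)) = mat_diag m (\<lambda>i. sqrt (inverse (A $$ (i, i))))"
    using nonneg by (simp add: pseudo_inverse_mat_diag sqrt_mat_diag)
  then show ?thesis
    unfolding corr_def Let_def
    by (simp add: mat_diag_mult_left[OF A])
      (subst mat_diag_mult_right[where nr = m], auto simp: real_sqrt_inverse divide_inverse)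
qed

subsection \<open>The projection directions\<close>

text \<open>Here \<open>b\<close> is the column of the inverse of \<open>G\<close> with index
  \<open>r\<close>, and \<open>b r\<close> equals the quadratic form of \<open>G\<close> at
  \<open>b\<close>, so dividing by \<open>sqrt (b r)\<close> normalises the vector that
  \<open>b\<close> represents. Both claims compare \<open>b\<close> with the basis vector
  \<open>e\<close>.\<close>

lemma normalized_solution:
  fixes G :: "nat \<Rightarrow> nat \<Rightarrow> real" and b :: "nat \<Rightarrow> real"
  assumes r: "r < m"
    and sol: "\<And>a. a < m \<Longrightarrow> (\<Sum>c<m. G a c * b c) = of_bool (a = r)"
    and near: "\<And>x. L2_set (\<lambda>a. (\<Sum>c<m. G a c * x c) - x a) {..<m} \<le> \<delta> * L2_set x {..<m}"
    and "\<delta> < 1" and Grr: "G r r = 1" and sym: "\<And>a c. G a c = G c a"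
    and psd: "\<And>x. 0 \<le> (\<Sum>a<m. x a * (\<Sum>c<m. G a c * x c))"
  shows "1 \<le> b r" "L2_set (\<lambda>a. b a / sqrt (b r) - of_bool (a = r)) {..<m} \<le> 2 * \<delta> / (1 - \<delta>)"
proof -
  define e :: "nat \<Rightarrow> real" where "e a = of_bool (a = r)" for a
  have sum_e: "(\<Sum>a<m. e a * f a) = f r" for f
    using r by (simp add: e_def of_bool_def if_distrib[where f = "\<lambda>t. t * _"] cong: if_cong)
  have norm_e: "L2_set e {..<m} = 1"
    using sum_e[of e] by (simp add: L2_set_def power2_eq_square) (simp add: e_def)
  have "0 \<le> \<delta>"
    using order_trans[OF L2_set_nonneg near[of e]] by (simp add: norm_e)
  \<comment> \<open>The quadratic form at \<open>b - e\<close>: since \<open>G b = e\<close> and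
    \<open>G r r = 1\<close>, it collapses to \<open>b r - 1\<close>, and nonnegativity gives the
    first claim.\<close>
  have "(\<Sum>a<m. (b a - e a) * (\<Sum>c<m. G a c * (b c - e c)))
      = (\<Sum>a<m. (b a - e a) * (e a - G a r))"
  proof (rule sum.cong[OF refl])
    fix a assume "a \<in> {..<m}"
    then have "(\<Sum>c<m. G a c * (b c - e c)) = e a - (\<Sum>c<m. e c * G a c)"
      using sol[of a] by (simp add: right_diff_distrib sum_subtractf e_def mult.commute)
    then show "(b a - e a) * (\<Sum>c<m. G a c * (b c - e c)) = (b a - e a) * (e a - G a r)"
      by (simp add: sum_e)
  qed
  also have "\<dots> = (\<Sum>a<m. e a * b a) - (\<Sum>a<m. G r a * b a) - (\<Sum>a<m. e a * e a) + (\<Sum>a<m. e a * G a r)"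
    by (simp add: algebra_simps sum_subtractf sum.distrib sym[of r])
  also have "\<dots> = b r - 1"
    unfolding sum_e using sol[OF r] by (simp add: e_def Grr)
  finally show br: "1 \<le> b r"
    using psd[of "\<lambda>a. b a - e a"] by simp
  define \<kappa> where "\<kappa> = sqrt (b r)"
  have \<kappa>: "1 \<le> \<kappa>" "\<kappa>\<^sup>2 = b r" using br by (auto simp: \<kappa>_def)
  \<comment> \<open>As \<open>G b = e\<close>, the near-isometry hypothesis at \<open>b\<close>
    bounds the distance from \<open>b\<close> to \<open>e\<close> by \<delta> times the norm of
    \<open>b\<close>; the triangle inequality then bounds that norm by
    \<open>1 / (1 - \<delta>)\<close>.\<close>
  have "L2_set (\<lambda>a. b a - e a) {..<m} = L2_set (\<lambda>a. (\<Sum>c<m. G a c * b c) - b a) {..<m}"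
    unfolding L2_set_def using sol
    by (intro arg_cong[where f = sqrt] sum.cong) (auto simp: e_def power2_commute)
  then have diff: "L2_set (\<lambda>a. b a - e a) {..<m} \<le> \<delta> * L2_set b {..<m}"
    using near[of b] by simp
  have "L2_set b {..<m} \<le> L2_set (\<lambda>a. b a - e a) {..<m} + L2_set e {..<m}"
    using L2_set_triangle_ineq[of "\<lambda>a. b a - e a" e] by simp
  then have "L2_set b {..<m} * (1 - \<delta>) \<le> 1"
    using diff by (simp add: norm_e algebra_simps)
  then have nb: "L2_set b {..<m} \<le> 1 / (1 - \<delta>)"
    using \<open>\<delta> < 1\<close> by (simp add: field_simps)
  have diff': "L2_set (\<lambda>a. b a - e a) {..<m} \<le> \<delta> / (1 - \<delta>)"
    using order_trans[OF diff mult_left_mono[OF nb \<open>0 \<le> \<delta>\<close>]] by simp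
  have "b r \<le> 1 / (1 - \<delta>)"
    using member_le_L2_set[of "{..<m}" r b] r nb by simp
  then have "1 - \<delta> \<le> 1 / b r"
    using br \<open>\<delta> < 1\<close> by (simp add: field_simps)
  also have "\<dots> \<le> 1 / \<kappa>"
    using \<kappa> br by (intro divide_left_mono) (auto simp: self_le_power simp flip: \<kappa>(2))
  finally have k': "1 - 1 / \<kappa> \<le> \<delta>" by simp
  \<comment> \<open>The error splits into \<open>(b - e) / \<kappa>\<close>, of norm at most
    \<open>\<delta> / (1 - \<delta>)\<close>, and the rescaling error of \<open>e\<close>, at most
    \<delta>; the latter is weakened to \<open>\<delta> / (1 - \<delta>)\<close> as well.\<close>
  have "L2_set (\<lambda>a. b a / \<kappa> - e a) {..<m}
      = L2_set (\<lambda>a. 1 / \<kappa> * (b a - e a) + - (1 - 1 / \<kappa>) * e a) {..<m}"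
    by (simp add: algebra_simps)
  also have "\<dots> \<le> L2_set (\<lambda>a. 1 / \<kappa> * (b a - e a)) {..<m} + L2_set (\<lambda>a. - (1 - 1 / \<kappa>) * e a) {..<m}"
    by (rule L2_set_triangle_ineq)
  also have "L2_set (\<lambda>a. - (1 - 1 / \<kappa>) * e a) {..<m} = L2_set (\<lambda>a. (1 - 1 / \<kappa>) * e a) {..<m}"
    unfolding L2_set_def power_mult_distrib power2_minus ..
  also have "\<dots> = 1 - 1 / \<kappa>"
    using \<kappa> by (subst L2_set_right_distrib[symmetric]) (auto simp: norm_e)
  also have "L2_set (\<lambda>a. 1 / \<kappa> * (b a - e a)) {..<m} = 1 / \<kappa> * L2_set (\<lambda>a. b a - e a) {..<m}"
    using \<kappa> by (subst L2_set_right_distrib[symmetric]) auto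
  also have "\<dots> \<le> 1 * L2_set (\<lambda>a. b a - e a) {..<m}"
    using \<kappa> by (intro mult_right_mono) auto
  also have "1 * L2_set (\<lambda>a. b a - e a) {..<m} + (1 - 1 / \<kappa>) \<le> \<delta> / (1 - \<delta>) + \<delta>"
    using diff' k' by simp
  also have "\<dots> \<le> \<delta> / (1 - \<delta>) + \<delta> / (1 - \<delta>)"
    using \<open>0 \<le> \<delta>\<close> \<open>\<delta> < 1\<close> by (intro add_left_mono) (simp add: le_divide_eq algebra_simps)
  also have "\<delta> / (1 - \<delta>) + \<delta> / (1 - \<delta>) = 2 * \<delta> / (1 - \<delta>)"
    by (simp add: add_divide_distrib[symmetric])
  finally show "L2_set (\<lambda>a. b a / sqrt (b r) - of_bool (a = r)) {..<m} \<le> 2 * \<delta> / (1 - \<delta>)"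
    by (simp add: \<kappa>_def e_def)
qed

text \<open>The inverse map is the rank within \<open>M\<close>. This turns sums over positions in
  the submatrix into sums over the original column indices.\<close>

lemma bij_betw_pick:
  assumes "finite M"
  shows "bij_betw (pick M) {..<card M} M"
proof (rule bij_betwI')
  show "(pick M x = pick M y) = (x = y)" if "x \<in> {..<card M}" "y \<in> {..<card M}" for x y
    using that pick_mono_le[of x M y] pick_mono_le[of y M x]
    by (metis lessThan_iff linorder_neq_iff)
  show "pick M x \<in> M" if "x \<in> {..<card M}" for x
    using that by (auto intro: pick_in_set_le)
  show "\<exists>x\<in>{..<card M}. y = pick M x" if "y \<in> M" for y
  proof
    show "y = pick M (card {a \<in> M. a < y})" using pick_card_in_set[OF that] by simp
    show "card {a \<in> M. a < y} \<in> {..<card M}"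
      using that assms by (auto intro!: psubset_card_mono)
  qed
qed

lemma
  assumes "M \<subseteq> {..<dim_col X}"
  shows cols_sub_carrier: "cols_sub X M \<in> carrier_mat (dim_row X) (card M)"
    and cols_sub_index: "k < dim_row X \<Longrightarrow> a < card M \<Longrightarrow> cols_sub X M $$ (k, a) = X $$ (k, pick M a)"
proof -
  have *: "{j. j < dim_col X \<and> j \<in> M} = M" using assms by auto
  show "cols_sub X M \<in> carrier_mat (dim_row X) (card M)"
    unfolding cols_sub_def carrier_mat_def by (simp add: dim_submatrix *)
  show "cols_sub X M $$ (k, a) = X $$ (k, pick M a)" if "k < dim_row X" "a < card M"
    unfolding cols_sub_def using that by (subst submatrix_index) (auto simp: * pick_UNIV)
qed

text \<open>The vector \<open>u\<^sub>j\<close> of the overview. It depends on the column only and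
  not on a model.\<close>

definition unit_col :: "real mat \<Rightarrow> nat \<Rightarrow> real vec" where
  "unit_col X j = (1 / norm2 (col X j)) \<cdot>\<^sub>v col X j"

section \<open>Linear algebra of one fixed model\<close>

context
  fixes X :: "real mat" and M :: "nat set" and s :: nat
  assumes M: "M \<in> models (dim_col X) s" and rip: "rip_const X s < 1"
begin

definition "XM = cols_sub X M"
definition "colnorm (a :: nat) = norm2 (col XM a)"
definition "ncol k a = XM $$ (k, a) / colnorm a"
text \<open>The matrix \<open>G\<close> of the overview as a function. Written as a sum, it is
  symmetric for all indices, as \<open>normalized_solution\<close> requires, and not only for those
  below \<open>card M\<close>.\<close>

definition "ncorr a b = (\<Sum>k<dim_row X. ncol k a * ncol k b)"

lemma XM_carrier: "XM \<in> carrier_mat (dim_row X) (card M)"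
  using M by (auto simp: XM_def models_def intro: cols_sub_carrier)

lemma gram_XM_carrier: "gram XM \<in> carrier_mat (card M) (card M)"
  using XM_carrier by (auto simp: gram_def)

lemma gram_XM_index:
  "a < card M \<Longrightarrow> b < card M \<Longrightarrow> gram XM $$ (a, b) = (\<Sum>k<dim_row X. XM $$ (k, a) * XM $$ (k, b))"
  using XM_carrier by (auto simp: gram_def scalar_prod_def atLeast0LessThan intro!: sum.cong)

lemma gram_XM_diag: "a < card M \<Longrightarrow> gram XM $$ (a, a) = (colnorm a)\<^sup>2"
  using XM_carrier by (auto simp: gram_def colnorm_def norm2_square)

lemma corr_XM:
  "corr (gram XM) = mat (card M) (card M) (\<lambda>(a, b). gram XM $$ (a, b) / (colnorm a * colnorm b))"
  using gram_XM_diag by (subst corr_eq[OF gram_XM_carrier]) (auto simp: colnorm_def)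

lemma corr_XM_near:
  "L2_set (\<lambda>a. (\<Sum>c<card M. corr (gram XM) $$ (a, c) * x c) - x a) {..<card M}
     \<le> rip_const X s * L2_set x {..<card M}"
proof -
  let ?v = "vec (card M) x" and ?C = "corr (gram XM)"
  have C: "?C \<in> carrier_mat (card M) (card M)" by (simp add: corr_XM)
  have "(?C - 1\<^sub>m (card M)) *\<^sub>v ?v = ?C *\<^sub>v ?v - ?v"
    using C minus_mult_distrib_mat_vec[OF C, of "1\<^sub>m (card M)" ?v] by auto
  moreover have "norm2 ((?C - 1\<^sub>m (card M)) *\<^sub>v ?v) \<le> rip_const X s * norm2 ?v"
    unfolding XM_def by (rule norm2_le_rip_const[OF M]) simp
  moreover have "norm2 ?v = L2_set x {..<card M}"
    unfolding norm2_def by (intro L2_set_cong) auto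
  moreover have "norm2 (?C *\<^sub>v ?v - ?v) = L2_set (\<lambda>a. (\<Sum>c<card M. ?C $$ (a, c) * x c) - x a) {..<card M}"
    unfolding norm2_def using C
    by (intro L2_set_cong) (auto simp: scalar_prod_def atLeast0LessThan)
  ultimately show ?thesis by simp
qed

text \<open>A zero column would make the corresponding row of the correlation matrix vanish, so the
  matrix minus the identity would send a basis vector to one with an entry -1, contradicting
  \<delta> < 1.\<close>

lemma colnorm_pos:
  assumes a: "a < card M"
  shows "0 < colnorm a"
proof (rule ccontr)
  assume "\<not> 0 < colnorm a"
  then have "colnorm a = 0"
    using norm2_nonneg[of "col XM a"] by (simp add: colnorm_def not_less)
  let ?e = "\<lambda>c. of_bool (c = a) :: real"
  have "1 \<le> L2_set (\<lambda>b. \<bar>(\<Sum>c<card M. corr (gram XM) $$ (b, c) * ?e c) - ?e b\<bar>) {..<card M}"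
    using a member_le_L2_set[of "{..<card M}" a "\<lambda>b. \<bar>(\<Sum>c<card M. corr (gram XM) $$ (b, c) * ?e c) - ?e b\<bar>"]
    by (simp add: corr_XM \<open>colnorm a = 0\<close>)
  also have "\<dots> \<le> rip_const X s * L2_set ?e {..<card M}"
    using corr_XM_near[of ?e] by (simp add: L2_set_def)
  also have "L2_set ?e {..<card M} = 1"
    using a by (simp add: L2_set_def of_bool_def if_distrib[where f = "\<lambda>t. t ^ 2"] cong: if_cong)
  finally show False using rip by simp
qed

lemma ncorr_eq: "a < card M \<Longrightarrow> b < card M \<Longrightarrow> ncorr a b = gram XM $$ (a, b) / (colnorm a * colnorm b)"
  by (simp add: ncorr_def ncol_def gram_XM_index sum_divide_distrib)

lemma ncorr_near:
  "L2_set (\<lambda>a. (\<Sum>c<card M. ncorr a c * x c) - x a) {..<card M} \<le> rip_const X s * L2_set x {..<card M}"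
  using corr_XM_near[of x] by (simp add: corr_XM ncorr_eq cong: L2_set_cong_simp)

text \<open>This serves twice: it shows that \<open>ncorr\<close> is nonnegative, and it later
  computes the norm of \<open>proj_vec\<close>.\<close>

lemma ncorr_quadratic:
  "(\<Sum>a<card M. x a * (\<Sum>c<card M. ncorr a c * x c)) = (\<Sum>k<dim_row X. (\<Sum>a<card M. ncol k a * x a)\<^sup>2)"
proof -
  have "(\<Sum>a<card M. x a * (\<Sum>c<card M. ncorr a c * x c))
      = (\<Sum>a<card M. \<Sum>c<card M. \<Sum>k<dim_row X. (ncol k a * x a) * (ncol k c * x c))"
    by (simp add: ncorr_def sum_distrib_left sum_distrib_right mult_ac)
  also have "\<dots> = (\<Sum>a<card M. \<Sum>k<dim_row X. \<Sum>c<card M. (ncol k a * x a) * (ncol k c * x c))"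
    by (intro sum.cong refl sum.swap)
  also have "\<dots> = (\<Sum>k<dim_row X. \<Sum>a<card M. \<Sum>c<card M. (ncol k a * x a) * (ncol k c * x c))"
    by (rule sum.swap)
  also have "\<dots> = (\<Sum>k<dim_row X. (\<Sum>a<card M. ncol k a * x a)\<^sup>2)"
    by (simp add: power2_eq_square sum_product)
  finally show ?thesis .
qed

text \<open>A kernel vector, rescaled by the column norms, becomes a kernel vector \<open>x\<close>
  of \<open>ncorr\<close>. The near-isometry bound then says that the norm of \<open>x\<close> is at
  most \<delta> times itself, so \<open>x = 0\<close>.\<close>

lemma det_gram_XM: "Determinant.det (gram XM) \<noteq> 0"
proof
  assume "Determinant.det (gram XM) = 0"
  then obtain v where v: "v \<in> carrier_vec (card M)" "v \<noteq> 0\<^sub>v (card M)" "gram XM *\<^sub>v v = 0\<^sub>v (card M)"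
    using det_0_iff_vec_prod_zero[OF gram_XM_carrier] by auto
  define x where "x a = colnorm a * v $ a" for a
  have "(\<Sum>c<card M. ncorr a c * x c) = 0" if a: "a < card M" for a
  proof -
    have "(\<Sum>c<card M. ncorr a c * x c) = (\<Sum>c<card M. gram XM $$ (a, c) * v $ c) / colnorm a"
      using a colnorm_pos[THEN less_imp_neq, symmetric]
      by (simp add: ncorr_eq x_def sum_divide_distrib)
    also have "(\<Sum>c<card M. gram XM $$ (a, c) * v $ c) = (gram XM *\<^sub>v v) $ a"
      using a v(1) gram_XM_carrier by (auto simp: scalar_prod_def atLeast0LessThan intro!: sum.cong)
    finally show ?thesis using a v(3) by simp
  qed
  then have "L2_set (\<lambda>a. - x a) {..<card M} \<le> rip_const X s * L2_set x {..<card M}"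
    using ncorr_near[of x] by (simp cong: L2_set_cong_simp)
  then have "L2_set x {..<card M} * (1 - rip_const X s) \<le> 0"
    by (simp add: L2_set_def algebra_simps)
  then have "L2_set x {..<card M} = 0"
    using rip L2_set_nonneg[of x "{..<card M}"] by (simp add: mult_le_0_iff)
  then have "\<forall>a<card M. x a = 0"
    by (simp add: L2_set_eq_0_iff)
  then have "v $ a = 0" if "a < card M" for a
    using that colnorm_pos[OF that] by (auto simp: x_def)
  then show False using v(1,2) by (auto intro: eq_vecI)
qed

text \<open>This replaces the inverse by a linear system: the projection vector is a combination of
  the columns of \<open>XM\<close> whose coefficients solve the normal equations with a basis vector
  on the right.\<close>

lemma proj_vec_solution:
  assumes i: "i \<in> M"
  obtains c :: "nat \<Rightarrow> real"
  where "\<And>k. k < dim_row X \<Longrightarrow> proj_vec X M i $ k = (\<Sum>a<card M. XM $$ (k, a) * c a)"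
    and "\<And>a. a < card M \<Longrightarrow> (\<Sum>b<card M. gram XM $$ (a, b) * c b) = of_bool (a = rank_in M i)"
    and "dim_vec (proj_vec X M i) = dim_row X"
proof -
  let ?G = "gram XM" and ?m = "card M"
  let ?e = "unit_vec ?m (rank_in M i) :: real vec"
  have "?G \<in> Units (ring_mat TYPE(real) ?m ())"
    using det_non_zero_imp_unit[OF gram_XM_carrier det_gram_XM] .
  then obtain B where "mat_inverse ?G = Some B"
    using mat_inverse(1)[OF gram_XM_carrier, of "()"] by fastforce
  with mat_inverse(2)[OF gram_XM_carrier] have B: "B \<in> carrier_mat ?m ?m" and BG: "B * ?G = 1\<^sub>m ?m"
    and inv: "the (mat_inverse ?G) = B" by auto
  \<comment> \<open>Symmetry of the Gram matrix makes the transpose of the left inverse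
    \<open>B\<close> a right inverse, so \<open>c\<close> below solves the system.\<close>
  have sym: "transpose_mat ?G = ?G"
    unfolding gram_def using XM_carrier by (subst transpose_mult) auto
  define c where "c = transpose_mat B *\<^sub>v ?e"
  have c: "c \<in> carrier_vec ?m" using B by (auto simp: c_def)
  have "?G *\<^sub>v c = (transpose_mat ?G * transpose_mat B) *\<^sub>v ?e"
    unfolding c_def sym using B gram_XM_carrier by (intro assoc_mult_mat_vec[symmetric]) auto
  also have "transpose_mat ?G * transpose_mat B = 1\<^sub>m ?m"
    using transpose_mult[OF B gram_XM_carrier] BG by simp
  finally have Gc: "?G *\<^sub>v c = ?e" by simp
  have "proj_vec X M i = XM *\<^sub>v c"
  proof -
    have "transpose_mat (B * transpose_mat XM) = XM * transpose_mat B"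
      using XM_carrier B by (subst transpose_mult) auto
    moreover have "(XM * transpose_mat B) *\<^sub>v ?e = XM *\<^sub>v c"
      unfolding c_def using XM_carrier B by (intro assoc_mult_mat_vec) auto
    ultimately show ?thesis
      using inv unfolding proj_vec_def Let_def XM_def[symmetric] by simp
  qed
  show ?thesis
  proof
    show "proj_vec X M i $ k = (\<Sum>a<?m. XM $$ (k, a) * c $ a)" if "k < dim_row X" for k
      using that c XM_carrier unfolding \<open>proj_vec X M i = XM *\<^sub>v c\<close>
      by (auto simp: scalar_prod_def atLeast0LessThan intro!: sum.cong)
    show "(\<Sum>b<?m. ?G $$ (a, b) * c $ b) = of_bool (a = rank_in M i)" if a: "a < ?m" for a
    proof -
      have "(\<Sum>b<?m. ?G $$ (a, b) * c $ b) = (?G *\<^sub>v c) $ a"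
        using a c gram_XM_carrier by (auto simp: scalar_prod_def atLeast0LessThan intro!: sum.cong)
      then show ?thesis using a by (simp add: Gc unit_vec_def)
    qed
    show "dim_vec (proj_vec X M i) = dim_row X"
      using XM_carrier \<open>proj_vec X M i = XM *\<^sub>v c\<close> by auto
  qed
qed

lemma colnorm_pick: "a < card M \<Longrightarrow> colnorm a = norm2 (col X (pick M a))"
proof -
  assume a: "a < card M"
  have "pick M a < dim_col X"
    using a M pick_in_set_le[OF a] by (auto simp: models_def)
  then have "col XM a = col X (pick M a)"
    using a M XM_carrier by (intro eq_vecI) (auto simp: XM_def models_def cols_sub_index)
  then show ?thesis by (simp add: colnorm_def)
qed

lemma ncol_scalar_prod:
  assumes "a < card M" "z \<in> carrier_vec (dim_row X)"
  shows "unit_col X (pick M a) \<bullet> z = (\<Sum>k<dim_row X. ncol k a * z $ k)"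
  unfolding scalar_prod_def
proof (rule sum.cong)
  fix k assume "k \<in> {..<dim_row X}"
  moreover have "pick M a < dim_col X"
    using assms M pick_in_set_le[OF assms(1)] by (auto simp: models_def)
  ultimately show "unit_col X (pick M a) $ k * z $ k = ncol k a * z $ k"
    using assms M XM_carrier
    by (simp add: unit_col_def colnorm_pick ncol_def) (simp add: XM_def cols_sub_index models_def)
qed (use assms in auto)

text \<open>A deterministic comparison: the right-hand side involves the model only through which of
  the fixed numbers \<open>unit_col X j \<bullet> z\<close> appear.\<close>

lemma proj_dir_le:
  assumes i: "i \<in> M" and z: "z \<in> carrier_vec (dim_row X)"
  shows "\<bar>proj_dir X M i \<bullet> z\<bar> \<le> \<bar>unit_col X i \<bullet> z\<bar>
    + 2 * rip_const X s / (1 - rip_const X s) * sqrt (\<Sum>j\<in>M. (unit_col X j \<bullet> z)\<^sup>2)"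
proof -
  define m r \<delta> where "m = card M" and "r = rank_in M i" and "\<delta> = rip_const X s"
  define v where "v = proj_vec X M i"
  have fin: "finite M" using M by (auto simp: models_def intro: finite_subset)
  have pick_r: "pick M r = i"
    using pick_card_in_set[OF i] by (simp add: r_def rank_in_def)
  have r: "r < m"
    unfolding r_def m_def rank_in_def using i fin by (auto intro!: psubset_card_mono)
  obtain c where vk: "\<And>k. k < dim_row X \<Longrightarrow> v $ k = (\<Sum>a<m. XM $$ (k, a) * c a)"
    and sol: "\<And>a. a < m \<Longrightarrow> (\<Sum>b<m. gram XM $$ (a, b) * c b) = of_bool (a = r)"
    and dim_v: "dim_vec v = dim_row X"
    using proj_vec_solution[OF i, folded m_def r_def v_def] by blast
  have pos: "0 < colnorm a" if "a < m" for a using that colnorm_pos by (simp add: m_def)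
  \<comment> \<open>The factor \<open>colnorm a\<close> passes to normalised columns;
    \<open>colnorm r\<close> makes the right-hand side of the system exactly the basis
    vector.\<close>
  define b where "b a = colnorm r * colnorm a * c a" for a
  have solb: "(\<Sum>a'<m. ncorr a a' * b a') = of_bool (a = r)" if a: "a < m" for a
  proof -
    have "(\<Sum>a'<m. ncorr a a' * b a') = colnorm r / colnorm a * (\<Sum>b<m. gram XM $$ (a, b) * c b)"
      unfolding sum_distrib_left
      using a pos[THEN less_imp_neq, symmetric] by (intro sum.cong) (auto simp: m_def ncorr_eq b_def)
    then show ?thesis using sol[OF a] pos[OF a] by (cases "a = r") simp_all
  qed
  have "ncorr r r = 1"
    using r pos[OF r] by (simp add: m_def ncorr_eq gram_XM_diag power2_eq_square)
  have sym: "ncorr a a' = ncorr a' a" for a a' by (simp add: ncorr_def mult.commute)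
  have psd: "0 \<le> (\<Sum>a<m. x a * (\<Sum>c<m. ncorr a c * x c))" for x
    unfolding m_def ncorr_quadratic by (simp add: sum_nonneg)
  have near': "L2_set (\<lambda>a. (\<Sum>c<m. ncorr a c * x c) - x a) {..<m} \<le> \<delta> * L2_set x {..<m}" for x
    unfolding m_def \<delta>_def by (rule ncorr_near)
  have "\<delta> < 1" using rip by (simp add: \<delta>_def)
  note sol_thms = normalized_solution[where G = ncorr, OF r _ near' \<open>\<delta> < 1\<close> \<open>ncorr r r = 1\<close> sym psd]
  have br: "1 \<le> b r"
    by (rule sol_thms(1)) (rule solb)
  have near: "L2_set (\<lambda>a. b a / sqrt (b r) - of_bool (a = r)) {..<m} \<le> 2 * \<delta> / (1 - \<delta>)"
    by (rule sol_thms(2)) (rule solb)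
  have v_b: "v $ k = (\<Sum>a<m. ncol k a * b a) / colnorm r" if "k < dim_row X" for k
  proof -
    have "XM $$ (k, a) * c a = ncol k a * b a / colnorm r" if "a < m" for a
      using pos[OF that] pos[OF r] by (simp add: ncol_def b_def)
    then show ?thesis
      unfolding vk[OF that] sum_divide_distrib by (intro sum.cong) auto
  qed
  \<comment> \<open>The quadratic form of \<open>ncorr\<close> at \<open>b\<close> is
    \<open>b r\<close>, as \<open>b\<close> solves the system. So normalising \<open>v\<close>
    cancels \<open>colnorm r\<close> and leaves the coefficients
    \<open>b a / sqrt (b r)\<close>.\<close>
  have "(norm2 v)\<^sup>2 = (\<Sum>k<dim_row X. (\<Sum>a<m. ncol k a * b a)\<^sup>2) / (colnorm r)\<^sup>2"
    unfolding norm2_square scalar_prod_def dim_v sum_divide_distrib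
    by (intro sum.cong) (auto simp: v_b power2_eq_square)
  also have "(\<Sum>k<dim_row X. (\<Sum>a<m. ncol k a * b a)\<^sup>2)
      = (\<Sum>a<m. b a * (\<Sum>c<m. ncorr a c * b c))"
    unfolding m_def by (rule ncorr_quadratic[symmetric])
  also have "\<dots> = (\<Sum>a<m. b a * of_bool (a = r))"
    by (simp add: solb)
  also have "\<dots> = b r" using r by simp
  finally have "(norm2 v)\<^sup>2 = (sqrt (b r) / colnorm r)\<^sup>2"
    using br by (simp add: power_divide)
  then have norm_v: "norm2 v = sqrt (b r) / colnorm r"
    using br pos[OF r] by (subst (asm) power2_eq_iff_nonneg) auto
  then have "norm2 v \<noteq> 0" using br pos[OF r] by auto
  then have "v \<noteq> 0\<^sub>v (dim_row X)" using norm2_eq_0_iff[of v] dim_v by auto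
  then have dir: "proj_dir X M i = (1 / norm2 v) \<cdot>\<^sub>v v"
    unfolding proj_dir_def Let_def v_def[symmetric] by simp
  define g where "g a = (\<Sum>k<dim_row X. ncol k a * z $ k)" for a
  have g: "unit_col X (pick M a) \<bullet> z = g a" if "a < m" for a
    using that z unfolding g_def m_def by (rule ncol_scalar_prod)
  have "proj_dir X M i \<bullet> z = (\<Sum>k<dim_row X. \<Sum>a<m. ncol k a * (b a / sqrt (b r)) * z $ k)"
    unfolding dir scalar_prod_def
  proof (rule sum.cong)
    fix k assume k: "k \<in> {..<dim_row X}"
    then have "(1 / norm2 v \<cdot>\<^sub>v v) $ k = (\<Sum>a<m. ncol k a * b a) / sqrt (b r)"
      using v_b[of k] dim_v norm_v pos[OF r] by simp
    then show "(1 / norm2 v \<cdot>\<^sub>v v) $ k * z $ k = (\<Sum>a<m. ncol k a * (b a / sqrt (b r)) * z $ k)"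
      by (simp add: sum_divide_distrib sum_distrib_right)
  qed (use z in auto)
  also have "\<dots> = (\<Sum>a<m. \<Sum>k<dim_row X. ncol k a * (b a / sqrt (b r)) * z $ k)"
    by (rule sum.swap)
  also have "\<dots> = (\<Sum>a<m. g a * (b a / sqrt (b r)))"
    by (simp add: g_def sum_distrib_left sum_distrib_right mult_ac)
  \<comment> \<open>The basis vector contributes the main term \<open>g r\<close>; Cauchy-Schwarz
    handles the remainder.\<close>
  also have "\<dots> = (\<Sum>a<m. g a * of_bool (a = r)) + (\<Sum>a<m. g a * (b a / sqrt (b r) - of_bool (a = r)))"
    unfolding sum.distrib[symmetric] by (simp add: right_diff_distrib)
  also have "(\<Sum>a<m. g a * of_bool (a = r)) = g r" using r by simp
  finally have "proj_dir X M i \<bullet> z = g r + (\<Sum>a<m. g a * (b a / sqrt (b r) - of_bool (a = r)))" .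
  then have "\<bar>proj_dir X M i \<bullet> z\<bar> \<le> \<bar>g r\<bar> + \<bar>\<Sum>a<m. g a * (b a / sqrt (b r) - of_bool (a = r))\<bar>"
    by (simp only: abs_triangle_ineq)
  also have "\<bar>\<Sum>a<m. g a * (b a / sqrt (b r) - of_bool (a = r))\<bar>
      \<le> (\<Sum>a<m. \<bar>g a\<bar> * \<bar>b a / sqrt (b r) - of_bool (a = r)\<bar>)"
    unfolding abs_mult[symmetric] by (rule sum_abs)
  also have "\<dots> \<le> L2_set g {..<m} * L2_set (\<lambda>a. b a / sqrt (b r) - of_bool (a = r)) {..<m}"
    by (rule L2_set_mult_ineq)
  also have "\<dots> \<le> L2_set g {..<m} * (2 * \<delta> / (1 - \<delta>))"
    using near by (intro mult_left_mono) auto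
  also have "L2_set g {..<m} = sqrt (\<Sum>a<m. (unit_col X (pick M a) \<bullet> z)\<^sup>2)"
    unfolding L2_set_def by (simp add: g)
  also have "(\<Sum>a<m. (unit_col X (pick M a) \<bullet> z)\<^sup>2) = (\<Sum>j\<in>M. (unit_col X j \<bullet> z)\<^sup>2)"
    unfolding m_def by (rule sum.reindex_bij_betw[OF bij_betw_pick[OF fin]])
  finally show ?thesis
    using g[OF r] by (simp add: pick_r \<delta>_def mult.commute)
qed

end

text \<open>The singleton \<open>{j}\<close> is a model because \<open>1 \<le> s\<close>, so
  positivity of column norms reaches every column.\<close>

lemma norm2_unit_col:
  assumes "j < dim_col X" "1 \<le> s" "rip_const X s < 1"
  shows "norm2 (unit_col X j) = 1"
proof -
  have M: "{j} \<in> models (dim_col X) s" using assms by (auto simp: models_def)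
  have "pick {j} 0 = j" by (simp add: Least_equality)
  then have "0 < norm2 (col X j)"
    using colnorm_pos[OF M assms(3), of 0] colnorm_pick[OF M assms(3), of 0] by simp
  then show ?thesis by (simp add: unit_col_def norm2_smult)
qed

text \<open>In the model \<open>{0}\<close> some norm is at most \<delta> times the norm 1 of a
  constant vector.\<close>

lemma rip_const_nonneg:
  assumes "1 \<le> s" "s \<le> dim_col X" "rip_const X s < 1"
  shows "0 \<le> rip_const X s"
proof -
  have M: "{0} \<in> models (dim_col X) s" using assms by (auto simp: models_def)
  show ?thesis
    using order_trans[OF L2_set_nonneg ncorr_near[OF M assms(3), of "\<lambda>_. 1"]]
    by (simp add: L2_set_def)
qed

subsection \<open>Maxima of sub-Gaussian variables\<close>

text \<open>Completing the square: exponential tilting shifts the mean, so the moment generating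
  function reduces to the total mass of a normal density.\<close>

lemma exp_times_std_normal_density:
  "std_normal_density x * exp (l * x) = exp (l\<^sup>2 / 2) * normal_density l 1 x"
proof -
  have "- x\<^sup>2 / 2 + l * x = l\<^sup>2 / 2 + - (x - l)\<^sup>2 / 2"
    by (simp add: power2_eq_square field_simps)
  then show ?thesis
    by (simp add: std_normal_density_def normal_density_def exp_add[symmetric] field_simps)
qed

text \<open>Independence factorises the exponential of the sum over coordinates, so the law of
  \<open>u \<bullet> \<xi> \<omega>\<close> itself need not be identified.\<close>

lemma std_gaussian_vec_exp:
  assumes \<xi>: "std_gaussian_vec P n \<xi>" and u: "u \<in> carrier_vec n"
  shows "integrable P (\<lambda>\<omega>. exp (u \<bullet> \<xi> \<omega>))" (is ?int)
    and "prob_space.expectation P (\<lambda>\<omega>. exp (u \<bullet> \<xi> \<omega>)) = exp ((norm2 u)\<^sup>2 / 2)" (is ?eq)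
proof -
  interpret prob_space P using \<xi> by (simp add: std_gaussian_vec_def)
  have dim: "\<And>\<omega>. \<omega> \<in> space P \<Longrightarrow> \<xi> \<omega> \<in> carrier_vec n"
    and dist: "\<And>i. i < n \<Longrightarrow> distributed P lborel (\<lambda>\<omega>. \<xi> \<omega> $ i) (\<lambda>x. ennreal (std_normal_density x))"
    and indep: "indep_vars (\<lambda>_. borel) (\<lambda>i \<omega>. \<xi> \<omega> $ i) {..<n}"
    using \<xi> by (auto simp: std_gaussian_vec_def)
  have int: "integrable P (\<lambda>\<omega>. exp (l * \<xi> \<omega> $ i))" if "i < n" for i l
    using distributed_integrable[OF dist[OF that], of "\<lambda>x. exp (l * x)"]
    by (simp add: exp_times_std_normal_density)
  have E: "expectation (\<lambda>\<omega>. exp (l * \<xi> \<omega> $ i)) = exp (l\<^sup>2 / 2)" if "i < n" for i l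
    using distributed_integral[OF dist[OF that], of "\<lambda>x. exp (l * x)"]
    by (simp add: exp_times_std_normal_density)
  have indep': "indep_vars (\<lambda>_. borel) (\<lambda>i \<omega>. exp (u $ i * \<xi> \<omega> $ i)) {..<n}"
    by (rule indep_vars_compose2[OF indep]) simp
  have eq: "exp (u \<bullet> \<xi> \<omega>) = (\<Prod>i<n. exp (u $ i * \<xi> \<omega> $ i))" if "\<omega> \<in> space P" for \<omega>
    using dim[OF that] by (simp add: scalar_prod_def exp_sum atLeast0LessThan)
  show ?int
    using indep_vars_integrable[OF _ indep'] int
    by (subst Bochner_Integration.integrable_cong[OF refl eq]) auto
  have "expectation (\<lambda>\<omega>. exp (u \<bullet> \<xi> \<omega>)) = expectation (\<lambda>\<omega>. \<Prod>i<n. exp (u $ i * \<xi> \<omega> $ i))"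
    by (rule Bochner_Integration.integral_cong[OF refl eq])
  also have "\<dots> = (\<Prod>i<n. expectation (\<lambda>\<omega>. exp (u $ i * \<xi> \<omega> $ i)))"
    using int by (intro indep_vars_lebesgue_integral indep') auto
  also have "\<dots> = exp (\<Sum>i<n. (u $ i)\<^sup>2 / 2)"
    by (simp add: E exp_sum)
  also have "(\<Sum>i<n. (u $ i)\<^sup>2 / 2) = (norm2 u)\<^sup>2 / 2"
    using u by (simp add: norm2_def L2_set_def sum_nonneg sum_divide_distrib)
  finally show ?eq .
qed

text \<open>The average of the exponential moments at \<open>l\<close> and \<open>- l\<close>; the
  hyperbolic cosine controls both tails at once.\<close>

lemma std_gaussian_vec_cosh:
  assumes \<xi>: "std_gaussian_vec P n \<xi>" and u: "u \<in> carrier_vec n" and 1: "norm2 u = 1"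
  shows "integrable P (\<lambda>\<omega>. cosh (l * (u \<bullet> \<xi> \<omega>)))"
    and "prob_space.expectation P (\<lambda>\<omega>. cosh (l * (u \<bullet> \<xi> \<omega>))) = exp (l\<^sup>2 / 2)"
proof -
  have eq: "cosh (l * (u \<bullet> \<xi> \<omega>)) = (exp ((l \<cdot>\<^sub>v u) \<bullet> \<xi> \<omega>) + exp ((- l \<cdot>\<^sub>v u) \<bullet> \<xi> \<omega>)) / 2"
    if "\<omega> \<in> space P" for \<omega>
  proof -
    have "\<xi> \<omega> \<in> carrier_vec n" using \<xi> that by (auto simp: std_gaussian_vec_def)
    then show ?thesis using u by (simp add: cosh_def)
  qed
  have c: "k \<cdot>\<^sub>v u \<in> carrier_vec n" for k using u by simp
  note exps = std_gaussian_vec_exp[OF \<xi> c]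
  show "integrable P (\<lambda>\<omega>. cosh (l * (u \<bullet> \<xi> \<omega>)))"
    by (subst Bochner_Integration.integrable_cong[OF refl eq]) (use exps(1)[of l] exps(1)[of "- l"] in auto)
  have "prob_space.expectation P (\<lambda>\<omega>. cosh (l * (u \<bullet> \<xi> \<omega>)))
      = integral\<^sup>L P (\<lambda>\<omega>. (exp ((l \<cdot>\<^sub>v u) \<bullet> \<xi> \<omega>) + exp ((- l \<cdot>\<^sub>v u) \<bullet> \<xi> \<omega>)) / 2)"
    by (rule Bochner_Integration.integral_cong[OF refl eq])
  also have "\<dots> = exp (l\<^sup>2 / 2)"
    using exps[of l] exps[of "- l"] by (simp add: norm2_smult 1)
  finally show "prob_space.expectation P (\<lambda>\<omega>. cosh (l * (u \<bullet> \<xi> \<omega>))) = exp (l\<^sup>2 / 2)" .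
qed

section \<open>Pointwise bounds by hyperbolic cosines\<close>

text \<open>With |x| = t + h and h > 0, the excess \<open>2 * t * h + h\<^sup>2\<close> is at most
  \<open>2 * exp (t * h)\<close> by the quadratic Taylor bound, where \<open>1 \<le> t\<close>
  absorbs \<open>h\<^sup>2\<close>. A second factor 2 comes from passing to
  \<open>cosh\<close>.\<close>

lemma square_excess_le_cosh:
  fixes t x :: real
  assumes "1 \<le> t"
  shows "x\<^sup>2 - t\<^sup>2 \<le> 4 * exp (- t\<^sup>2) * cosh (t * x)"
proof (cases "\<bar>x\<bar> \<le> t")
  case True
  then have "x\<^sup>2 - t\<^sup>2 \<le> 0"
    using abs_le_square_iff[of x t] by simp
  also have "0 \<le> 4 * exp (- t\<^sup>2) * cosh (t * x)"
    using cosh_real_nonneg by simp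
  finally show ?thesis .
next
  case False
  define h where "h = \<bar>x\<bar> - t"
  have h: "0 \<le> h" "\<bar>x\<bar> = t + h" using False by (auto simp: h_def)
  have "x\<^sup>2 - t\<^sup>2 = 2 * (t * h) + h\<^sup>2"
    by (subst power2_abs[symmetric]) (simp add: h power2_eq_square algebra_simps)
  also have "\<dots> \<le> 2 * (1 + t * h + (t * h)\<^sup>2 / 2)"
    using mult_right_mono[of 1 "t\<^sup>2" "h\<^sup>2"] assms by (simp add: power_mult_distrib)
  also have "\<dots> \<le> 2 * exp (t * h)"
    using exp_lower_Taylor_quadratic[of "t * h"] assms h by simp
  also have "\<dots> = 2 * exp (- t\<^sup>2) * exp (t * \<bar>x\<bar>)"
    by (simp add: h mult_exp_exp power2_eq_square algebra_simps)
  also have "exp (t * \<bar>x\<bar>) \<le> 2 * cosh (t * \<bar>x\<bar>)"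
    by (simp add: cosh_def)
  also have "cosh (t * \<bar>x\<bar>) = cosh (t * x)"
    by (cases "0 \<le> x") auto
  finally show ?thesis by simp
qed

text \<open>The excess terms are nonnegative, so their sum may be extended from \<open>M\<close> to
  \<open>J\<close>; the resulting bound is the same for all \<open>M\<close>.\<close>

lemma sum_squares_le_cosh:
  fixes g :: "'i \<Rightarrow> real"
  assumes "finite J" "M \<subseteq> J" "card M \<le> s" "1 \<le> t"
  shows "(\<Sum>j\<in>M. (g j)\<^sup>2) \<le> real s * t\<^sup>2 + (\<Sum>j\<in>J. 4 * exp (- t\<^sup>2) * cosh (t * g j))"
proof -
  have "(\<Sum>j\<in>M. (g j)\<^sup>2) \<le> (\<Sum>j\<in>M. t\<^sup>2 + 4 * exp (- t\<^sup>2) * cosh (t * g j))"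
    using square_excess_le_cosh[OF assms(4)] by (intro sum_mono) (simp add: diff_le_eq add.commute)
  also have "\<dots> = card M * t\<^sup>2 + (\<Sum>j\<in>M. 4 * exp (- t\<^sup>2) * cosh (t * g j))"
    by (simp add: sum.distrib)
  also have "\<dots> \<le> real s * t\<^sup>2 + (\<Sum>j\<in>J. 4 * exp (- t\<^sup>2) * cosh (t * g j))"
    using assms by (intro add_mono mult_right_mono sum_mono2) auto
  finally show ?thesis .
qed

text \<open>One summand dominates \<open>exp (l * \<bar>g i\<bar>)\<close>. The logarithm of the sum
  is then replaced by its tangent at \<open>Z\<close>, which leaves a bound affine in the sum, so
  expectations can be taken directly.\<close>

lemma abs_le_sum_cosh:
  fixes g :: "'i \<Rightarrow> real"
  assumes "finite J" "i \<in> J" "0 < l" "0 < Z"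
  shows "\<bar>g i\<bar> \<le> (ln Z - 1 + (\<Sum>j\<in>J. 2 * cosh (l * g j)) / Z) / l"
proof -
  let ?S = "\<Sum>j\<in>J. 2 * cosh (l * g j)"
  have "exp (l * \<bar>g i\<bar>) \<le> 2 * cosh (l * \<bar>g i\<bar>)"
    by (simp add: cosh_def)
  also have "cosh (l * \<bar>g i\<bar>) = cosh (l * g i)"
    by (cases "0 \<le> g i") auto
  also have "2 * cosh (l * g i) \<le> ?S"
    using assms by (intro member_le_sum) auto
  finally have S: "exp (l * \<bar>g i\<bar>) \<le> ?S" .
  then have "0 < ?S" using exp_gt_zero order_less_le_trans by blast
  then have "l * \<bar>g i\<bar> \<le> ln ?S" using S by (simp add: ln_ge_iff)
  also have "\<dots> = ln Z + ln (?S / Z)"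
    using \<open>0 < ?S\<close> assms by (simp add: ln_div)
  also have "ln (?S / Z) \<le> ?S / Z - 1"
    using \<open>0 < ?S\<close> assms by (intro ln_le_minus_one) simp
  finally show ?thesis using assms by (simp add: field_simps)
qed

text \<open>The set \<open>A\<close> and the index \<open>i\<close> may vary with \<omega>, and
  nothing is assumed about the joint law of the \<open>g j\<close>.\<close>

lemma (in prob_space) expectation_max_plus_root_le:
  fixes g :: "nat \<Rightarrow> 'a \<Rightarrow> real" and T :: "'a \<Rightarrow> real"
  assumes s: "1 \<le> s" "s \<le> p" and K: "0 \<le> K"
    and int: "\<And>j l. j < p \<Longrightarrow> integrable M (\<lambda>\<omega>. cosh (l * g j \<omega>))"
    and E: "\<And>j l. j < p \<Longrightarrow> expectation (\<lambda>\<omega>. cosh (l * g j \<omega>)) \<le> exp (l\<^sup>2 / 2)"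
    and T: "T \<in> borel_measurable M" "\<And>\<omega>. \<omega> \<in> space M \<Longrightarrow> 0 \<le> T \<omega>"
    and le: "\<And>\<omega>. \<omega> \<in> space M \<Longrightarrow> \<exists>A i. A \<subseteq> {..<p} \<and> card A \<le> s \<and> i \<in> A \<and>
      T \<omega> \<le> \<bar>g i \<omega>\<bar> + K * sqrt (\<Sum>j\<in>A. (g j \<omega>)\<^sup>2)"
  shows "integrable M T"
    and "expectation T \<le> sqrt (2 * ln (2 * real p)) + K * sqrt (2 * real s * ln (6 * real p / real s))"
proof -
  \<comment> \<open>\<open>T\<close> is dominated by \<open>F1 + K (F2 / (2 c) + c / 2)\<close>: \<open>F1\<close> linearises the logarithm in the
    log-sum-exp bound at \<open>Z\<close>, \<open>F2\<close> bounds a sum of \<open>s\<close> squares by truncation at \<open>t\<^sup>2\<close>, and the root of \<open>F2\<close>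
    is linearised at \<open>c\<^sup>2\<close>.\<close>
  define l where "l = sqrt (2 * ln (2 * real p))"
  \<comment> \<open>\<open>Z\<close> bounds the expectation of the sum of
    \<open>2 * cosh (l * g j \<omega>)\<close>; \<open>l\<close> is chosen so that
    \<open>ln Z = l\<^sup>2\<close>, which gives \<open>F1\<close> expectation at most
    \<open>l\<close>.\<close>
  define Z where "Z = 2 * real p * exp (l\<^sup>2 / 2)"
  \<comment> \<open>This truncation level makes \<open>exp (- t\<^sup>2 / 2)\<close> equal to
    \<open>s / (2 * p)\<close>.\<close>
  define t where "t = sqrt (2 * ln (2 * real p / real s))"
  define c where "c = sqrt (2 * real s * ln (6 * real p / real s))"
  have p: "0 < p" using s by simp
  have l: "0 < l" "l\<^sup>2 = 2 * ln (2 * real p)" using p by (auto simp: l_def)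
  have Z: "0 < Z" "ln Z = l\<^sup>2"
    using p by (auto simp: Z_def ln_mult l(2))
  \<comment> \<open>From \<open>s \<le> p\<close> and \<open>ln 2 \<ge> 2 / 3\<close> comes
    \<open>1 \<le> t\<close>, as the truncation bound demands.\<close>
  have ratio: "2 \<le> 2 * real p / real s" using s by (simp add: field_simps)
  have "ln 2 \<le> ln (2 * real p / real s)" using ratio by simp
  then have ln1: "1 \<le> 2 * ln (2 * real p / real s)"
    using ln2_ge_two_thirds by linarith
  then have t: "1 \<le> t" "t\<^sup>2 = 2 * ln (2 * real p / real s)" by (auto simp: t_def)
  have "ln (6 * real p / real s) = ln (3 * (2 * real p / real s))" by simp
  also have "\<dots> = ln 3 + ln (2 * real p / real s)"
    using s p by (intro ln_mult_pos) auto
  finally have "ln (6 * real p / real s) = ln 3 + ln (2 * real p / real s)" .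
  \<comment> \<open>This is where 6 = 3 * 2 comes from: the factor 3 exceeds e, so
    \<open>ln 3\<close> pays for the total excess \<open>2 * s\<close> in the bound for
    \<open>F2\<close>.\<close>
  moreover have "1 \<le> ln (3 :: real)"
    using exp_le by (simp add: ln_ge_iff)
  ultimately have ln6: "1 + ln (2 * real p / real s) \<le> ln (6 * real p / real s)" by simp
  then have c: "0 < c" "c\<^sup>2 = 2 * real s * ln (6 * real p / real s)"
    using ln1 s by (auto simp: c_def)
  define S where "S a k \<omega> = (\<Sum>j<p. a * cosh (k * g j \<omega>))" for a k \<omega>
  define F1 where "F1 \<omega> = (ln Z - 1 + S 2 l \<omega> / Z) / l" for \<omega>
  define F2 where "F2 \<omega> = real s * t\<^sup>2 + S (4 * exp (- t\<^sup>2)) t \<omega>" for \<omega>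
  define F where "F \<omega> = F1 \<omega> + K * (F2 \<omega> / (2 * c) + c / 2)" for \<omega>
  have T_le: "T \<omega> \<le> F \<omega>" if \<omega>: "\<omega> \<in> space M" for \<omega>
  proof -
    obtain A i where A: "A \<subseteq> {..<p}" "card A \<le> s" "i \<in> A"
      and T: "T \<omega> \<le> \<bar>g i \<omega>\<bar> + K * sqrt (\<Sum>j\<in>A. (g j \<omega>)\<^sup>2)"
      using le[OF \<omega>] by blast
    define q where "q = sqrt (\<Sum>j\<in>A. (g j \<omega>)\<^sup>2)"
    have "q\<^sup>2 \<le> F2 \<omega>"
      unfolding q_def F2_def S_def using sum_squares_le_cosh[of "{..<p}" A s t "\<lambda>j. g j \<omega>"] A t
      by (simp add: sum_nonneg)
    moreover have "2 * q * c \<le> q\<^sup>2 + c\<^sup>2"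
      using sum_squares_bound by blast
    ultimately have "2 * q * c \<le> F2 \<omega> + c\<^sup>2" by simp
    then have "q \<le> F2 \<omega> / (2 * c) + c / 2"
      using c by (simp add: field_simps power2_eq_square)
    moreover have "\<bar>g i \<omega>\<bar> \<le> F1 \<omega>"
      unfolding F1_def S_def using A l Z by (intro abs_le_sum_cosh) auto
    ultimately show ?thesis
      using T K unfolding F_def q_def by (meson add_mono mult_left_mono order_trans)
  qed
  have int_S: "integrable M (S a k)" for a k
    unfolding S_def by (intro Bochner_Integration.integrable_sum integrable_mult_right int) auto
  have E_S: "expectation (S a k) \<le> real p * a * exp (k\<^sup>2 / 2)" if "0 \<le> a" for a k
  proof -
    have "expectation (S a k) = (\<Sum>j<p. a * expectation (\<lambda>\<omega>. cosh (k * g j \<omega>)))"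
      unfolding S_def by (subst Bochner_Integration.integral_sum) (auto intro!: int)
    also have "\<dots> \<le> (\<Sum>j<p. a * exp (k\<^sup>2 / 2))"
      using E that by (intro sum_mono mult_left_mono) auto
    finally show ?thesis by (simp add: mult.assoc)
  qed
  have int1: "integrable M F1" and int2: "integrable M F2"
    unfolding F1_def F2_def using int_S by auto
  have int_F: "integrable M F" unfolding F_def using int1 int2 by auto
  show int_T: "integrable M T"
  proof (rule Bochner_Integration.integrable_bound[OF int_F T(1)])
    show "AE \<omega> in M. norm (T \<omega>) \<le> norm (F \<omega>)"
    proof (rule AE_I2)
      fix \<omega> assume "\<omega> \<in> space M"
      then show "norm (T \<omega>) \<le> norm (F \<omega>)"
        using T(2)[of \<omega>] T_le[of \<omega>] by simp
    qed
  qed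
  have "expectation F1 = (ln Z - 1 + expectation (S 2 l) / Z) / l"
    unfolding F1_def using int_S by (simp add: prob_space)
  also have "\<dots> \<le> (ln Z - 1 + real p * 2 * exp (l\<^sup>2 / 2) / Z) / l"
    using l(1) Z(1) E_S[of 2 l] by (intro divide_right_mono add_left_mono) auto
  also have "real p * 2 * exp (l\<^sup>2 / 2) / Z = 1"
    using p by (simp add: Z_def)
  also have "(ln Z - 1 + 1) / l = l"
    using l(1) by (simp add: Z power2_eq_square)
  finally have E1: "expectation F1 \<le> l" .
  \<comment> \<open>The weight times the moment is \<open>s / (2 * p)\<close>, so the
    \<open>p\<close> excess terms, each with factor 4, contribute at most
    \<open>2 * s\<close>.\<close>
  have "exp (- t\<^sup>2) * exp (t\<^sup>2 / 2) = exp (- ln (2 * real p / real s))"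
    unfolding mult_exp_exp t(2) by simp
  also have "\<dots> = real s / (2 * real p)"
    using s p by (simp add: exp_minus)
  finally have exp_t: "exp (- t\<^sup>2) * exp (t\<^sup>2 / 2) = real s / (2 * real p)" .
  have "expectation F2 = real s * t\<^sup>2 + expectation (S (4 * exp (- t\<^sup>2)) t)"
    unfolding F2_def using int_S by (simp add: prob_space)
  also have "\<dots> \<le> real s * t\<^sup>2 + 4 * real p * (exp (- t\<^sup>2) * exp (t\<^sup>2 / 2))"
    using E_S[of "4 * exp (- t\<^sup>2)" t] by (simp add: mult_ac)
  also have "\<dots> = real s * t\<^sup>2 + 2 * real s"
    unfolding exp_t using p by simp
  also have "\<dots> \<le> c\<^sup>2"
    using mult_left_mono[OF ln6, of "2 * real s"] unfolding t(2) c(2) by (simp add: algebra_simps)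
  finally have E2: "expectation F2 \<le> c\<^sup>2" .
  have "expectation T \<le> expectation F"
    using T_le by (intro integral_mono int_T int_F) auto
  also have "\<dots> = expectation F1 + K * (expectation F2 / (2 * c) + c / 2)"
    unfolding F_def using int1 int2 by (simp add: prob_space)
  also have "\<dots> \<le> l + K * (c\<^sup>2 / (2 * c) + c / 2)"
    using E1 E2 K c by (intro add_mono mult_left_mono divide_right_mono) auto
  also have "c\<^sup>2 / (2 * c) + c / 2 = c"
    using c(1) by (simp add: power2_eq_square)
  finally show "expectation T \<le> sqrt (2 * ln (2 * real p)) + K * sqrt (2 * real s * ln (6 * real p / real s))"
    by (simp add: l_def c_def)
qed

subsection \<open>The expectation of the maximal statistic\<close>

lemma unit_col_carrier [simp]: "unit_col X j \<in> carrier_vec (dim_row X)"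
  by (simp add: unit_col_def)

lemma proj_dir_carrier:
  assumes "M \<in> models (dim_col X) s" "rip_const X s < 1" "i \<in> M"
  shows "proj_dir X M i \<in> carrier_vec (dim_row X)"
proof -
  have "proj_vec X M i \<in> carrier_vec (dim_row X)"
    by (rule proj_vec_solution[OF assms]) (rule carrier_vecI)
  then show ?thesis by (simp add: proj_dir_def Let_def)
qed

text \<open>A maximum over an image of one finite index set, the form used for measurability and
  attainment.\<close>

lemma max_stat_eq:
  "max_stat X s z =
    Max ((\<lambda>q. \<bar>proj_dir X (fst q) (snd q) \<bullet> z\<bar>) ` (SIGMA M:models (dim_col X) s. M))"
proof -
  have "{\<bar>proj_dir X M i \<bullet> z\<bar> | M i. M \<in> models (dim_col X) s \<and> i \<in> M}
      = (\<lambda>q. \<bar>proj_dir X (fst q) (snd q) \<bullet> z\<bar>) ` (SIGMA M:models (dim_col X) s. M)"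
    by (auto simp: image_iff) blast+
  then show ?thesis by (simp add: max_stat_def)
qed

lemma finite_model: "M \<in> models p s \<Longrightarrow> finite M"
  by (auto simp: models_def intro: finite_subset)

lemma finite_model_pairs: "finite (SIGMA M:models p s. M)"
  by (rule finite_SigmaI[OF finite_models]) (rule finite_model)

lemma max_stat_attained:
  assumes "1 \<le> s" "s \<le> dim_col X"
  obtains M i where "M \<in> models (dim_col X) s" "i \<in> M" "max_stat X s z = \<bar>proj_dir X M i \<bullet> z\<bar>"
proof -
  let ?I = "SIGMA M:models (dim_col X) s. M"
  \<comment> \<open>\<open>Max\<close> is meaningful only for a nonempty set;
    \<open>1 \<le> s \<le> p\<close> provides this model.\<close>
  have "({0}, 0) \<in> ?I" using assms by (auto simp: models_def)
  then have "?I \<noteq> {}" by blast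
  then have "max_stat X s z \<in> (\<lambda>q. \<bar>proj_dir X (fst q) (snd q) \<bullet> z\<bar>) ` ?I"
    unfolding max_stat_eq using finite_model_pairs by (intro Max_in) auto
  then obtain q where "q \<in> ?I" "max_stat X s z = \<bar>proj_dir X (fst q) (snd q) \<bullet> z\<bar>"
    by blast
  then show ?thesis by (intro that[of "fst q" "snd q"]) auto
qed

lemma std_gaussian_vec_scalar_prod_measurable:
  assumes \<xi>: "std_gaussian_vec P n \<xi>" and w: "w \<in> carrier_vec n"
  shows "(\<lambda>\<omega>. w \<bullet> \<xi> \<omega>) \<in> borel_measurable P"
proof -
  have "(\<lambda>\<omega>. \<xi> \<omega> $ i) \<in> borel_measurable P" if "i < n" for i
    using \<xi> that distributed_measurable[of P lborel "\<lambda>\<omega>. \<xi> \<omega> $ i"]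
    by (auto simp: std_gaussian_vec_def)
  then have "(\<lambda>\<omega>. \<Sum>i<n. w $ i * \<xi> \<omega> $ i) \<in> borel_measurable P"
    by (intro borel_measurable_sum borel_measurable_times) auto
  moreover have "w \<bullet> \<xi> \<omega> = (\<Sum>i<n. w $ i * \<xi> \<omega> $ i)" if "\<omega> \<in> space P" for \<omega>
    using \<xi> that by (auto simp: std_gaussian_vec_def scalar_prod_def atLeast0LessThan)
  ultimately show ?thesis by (subst measurable_cong) auto
qed

theorem theorem3p3:
  fixes n p s :: nat and X :: "real mat" and P :: "'a measure" and \<xi> :: "'a \<Rightarrow> real vec"
    and \<delta> :: real
  assumes "1 \<le> s" and "s \<le> p"
    and "X \<in> carrier_mat n p"
    and "\<delta> = rip_const X s"
    and "\<delta> < 1"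
    and "std_gaussian_vec P n \<xi>"
  shows "integrable P (\<lambda>\<omega>. max_stat X s (\<xi> \<omega>)) \<and>
    prob_space.expectation P (\<lambda>\<omega>. max_stat X s (\<xi> \<omega>))
      \<le> sqrt (2 * ln (2 * real p))
         + 2 * \<delta> * (sqrt (1 + \<delta>) / (1 - \<delta>)) * sqrt (2 * real s * ln (6 * real p / real s))"
proof -
  interpret prob_space P using assms(6) by (simp add: std_gaussian_vec_def)
  have dims: "dim_row X = n" "dim_col X = p" using assms(3) by auto
  have rip: "rip_const X s < 1" using assms by simp
  have sp: "s \<le> dim_col X" using assms dims by simp
  have \<delta>: "0 \<le> \<delta>" using rip_const_nonneg[OF assms(1) sp rip] assms(4) by simp
  define K where "K = 2 * \<delta> / (1 - \<delta>)"
  have K: "0 \<le> K" using \<delta> assms(5) by (simp add: K_def)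
  define T where "T \<omega> = max_stat X s (\<xi> \<omega>)" for \<omega>
  have u: "unit_col X j \<in> carrier_vec n" for j using unit_col_carrier[of X j] by (simp add: dims)
  have u1: "norm2 (unit_col X j) = 1" if "j < p" for j
    using norm2_unit_col[OF _ assms(1) rip] that dims by simp
  have T_meas: "T \<in> borel_measurable P"
    unfolding T_def max_stat_eq
  proof (rule borel_measurable_Max[OF finite_model_pairs])
    fix q assume "q \<in> (SIGMA M:models (dim_col X) s. M)"
    then have "proj_dir X (fst q) (snd q) \<in> carrier_vec n"
      using proj_dir_carrier[OF _ rip] dims by auto
    then show "(\<lambda>\<omega>. \<bar>proj_dir X (fst q) (snd q) \<bullet> \<xi> \<omega>\<bar>) \<in> borel_measurable P"
      by (intro borel_measurable_abs std_gaussian_vec_scalar_prod_measurable[OF assms(6)])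
  qed
  have T_nonneg: "0 \<le> T \<omega>" for \<omega>
    by (rule max_stat_attained[OF assms(1) sp, of "\<xi> \<omega>"]) (simp add: T_def)
  have T_le: "\<exists>A i. A \<subseteq> {..<p} \<and> card A \<le> s \<and> i \<in> A \<and>
      T \<omega> \<le> \<bar>unit_col X i \<bullet> \<xi> \<omega>\<bar> + K * sqrt (\<Sum>j\<in>A. (unit_col X j \<bullet> \<xi> \<omega>)\<^sup>2)"
    if \<omega>: "\<omega> \<in> space P" for \<omega>
  proof -
    obtain M i where M: "M \<in> models (dim_col X) s" and i: "i \<in> M"
      and T: "T \<omega> = \<bar>proj_dir X M i \<bullet> \<xi> \<omega>\<bar>"
      using max_stat_attained[OF assms(1) sp] unfolding T_def by blast
    have "\<xi> \<omega> \<in> carrier_vec (dim_row X)"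
      using assms(6) \<omega> by (simp add: std_gaussian_vec_def dims)
    from proj_dir_le[OF M rip i this] show ?thesis
      using M i unfolding T K_def assms(4) by (auto simp: models_def dims)
  qed
  \<comment> \<open>The \<open>g j\<close> are the projections on the unit columns; each has the
    exact hyperbolic cosine moment, here used as an inequality.\<close>
  note bound = expectation_max_plus_root_le[OF assms(1,2) K
      std_gaussian_vec_cosh(1)[OF assms(6) u u1]
      eq_refl[OF std_gaussian_vec_cosh(2)[OF assms(6) u u1]] T_meas T_nonneg T_le]
  \<comment> \<open>The bound is already established with \<open>K\<close>; the factor
    \<open>sqrt (1 + \<delta>)\<close> is at least 1 since \<delta> is nonnegative.\<close>
  have "K * 1 \<le> K * sqrt (1 + \<delta>)"
    using K \<delta> by (intro mult_left_mono) auto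
  also have "\<dots> = 2 * \<delta> * (sqrt (1 + \<delta>) / (1 - \<delta>))"
    by (simp add: K_def)
  finally have "K * sqrt (2 * real s * ln (6 * real p / real s))
      \<le> 2 * \<delta> * (sqrt (1 + \<delta>) / (1 - \<delta>)) * sqrt (2 * real s * ln (6 * real p / real s))"
    using assms(1,2) by (intro mult_right_mono) auto
  then show ?thesis
    using bound unfolding T_def by auto
qed

end
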